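(* There exist a pairwise Markov random field $G$ with variable set $V$ and a target variable $X\in V$ such that the negated objective $f_{G,X}(\mathcal{A})=-d\big(b_X,\tilde b_X^{\mathcal{A}}\big)$, viewed as a set function of the set $\mathcal{A}\subseteq V\setminus\{X\}$ of explaining variables, is not submodular and is not monotonically increasing. Here $b_X$ is the belief of $X$ computed by belief propagation on $G$, $\tilde b_X^{\mathcal{A}}$ is the belief of $X$ computed by belief propagation on the subgraph of $G$ induced by $\mathcal{A}\cup\{X\}$, and $d$ is the symmetric KL-divergence $d(p,q)=\mathrm{KL}(p\|q)+\mathrm{KL}(q\|p)$.
   Context: A pairwise Markov random field (MRF) $G=(V,E)$ consists of a finite set $V=\{X_1,\dots,X_n\}$ of random variables, each taking values in $\{1,\dots,c\}$, a set $E$ of undirected edges, a prior distribution $\phi_i$ on $\{1,\dots,c\}$ for each $X_i$, and a compatibility function $\psi_{ij}(x_i,x_j)$ for each edge $(X_i,X_j)\in E$ (all $\phi_i,\psi_{ij}$ strictly positive). The joint distribution is $$P(V)=\frac1Z\prod_{i}\phi_i(X_i)\prod_{(X_i,X_j)\in E}\psi_{ij}(X_i,X_j),$$ with $Z$ the normalization constant. Belief propagation (BP). Let $\mathcal{N}(X_i)$ denote the set of neighbors of $X_i$. Messages $m_{i\to j}$, which are probability distributions on $\{1,\dots,c\}$, are updated in both directions on all edges by $$m_{i\to j}(x_j)=\frac{1}{Z_j}\sum_{x_i}\Big[\psi_{ij}(x_i,x_j)\,\phi_i(x_i)\prod_{k\in\mathcal{N}(X_i)\setminus\{j\}}m_{k\to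 i}(x_i)\Big]$$ until convergence ($Z_j$ is a normalization factor). Convergence is guaranteed when the graph is acyclic; $G$ is assumed to be such that BP converges on it. The belief of $X$ is the probability distribution $b_X(x)\propto\phi_X(x)\prod_{Y\in\mathcal{N}(X)}m_{Y\to X}(x)$. Subgraphs. A subgraph of $G$ is regarded as an MRF with the priors and compatibility functions inherited from $G$. Explaining subgraphs are required to be acyclic, so $f_{G,X}(\mathcal{A})$ is considered for those $\mathcal{A}\subseteq V\setminus\{X\}$ for which the subgraph induced by $\mathcal{A}\cup\{X\}$ is acyclic (this family is closed under taking subsets, and if $G$ itself is acyclic it consists of all subsets of $V\setminus\{X\}$). KL-divergence: $\mathrm{KL}(p\|q)=\sum_{x=1}^{c}p(x)\log\big(p(x)/q(x)\big)$. Submodularity: a set function $f$ is submodular if for all $\mathcal{A}\subset\mathcal{A}'$ and every element $Y\notin\mathcal{A}'$ (with all the sets involved in the domain of $f$), $f(\mathcal{A}\cup\{Y\})-f(\mathcal{A})\ge f(\mathcal{A}'\cup\{Y\})-f(\mathcal{A}')$. Monotonicity: $f$ is monotonically increasing if $\mathcal{A}\subset\mathcal{A}'$ implies $f(\mathcal{A})\le f(\mathcal{A}')$. *)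

theory Defs
  imports Complex_Main
begin

section \<open>Pairwise Markov random fields\<close>

text \<open>Each variable takes values in \<open>{1..states G}\<close>; edges are two-element sets of variables, and
  \<open>compat G i j x y\<close> is the value \<open>\<psi>\<close> of the edge \<open>{i, j}\<close> when \<open>i\<close> has value \<open>x\<close> and
  \<open>j\<close> has value \<open>y\<close>. The edges being undirected, this is one function per edge, read in either
  direction; hence the symmetry condition in \<open>is_mrf\<close>.\<close>

record 'v mrf =
  verts :: "'v set"
  edges :: "'v set set"
  states :: nat
  prior :: "'v \<Rightarrow> nat \<Rightarrow> real"
  compat :: "'v \<Rightarrow> 'v \<Rightarrow> nat \<Rightarrow> nat \<Rightarrow> real"

definition vals :: "'v mrf \<Rightarrow> nat set" where
  "vals G = {1..states G}"

definition pos_distr :: "nat set \<Rightarrow> (nat \<Rightarrow> real) \<Rightarrow> bool" where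
  "pos_distr C p \<longleftrightarrow> (\<forall>x\<in>C. 0 < p x) \<and> (\<Sum>x\<in>C. p x) = 1"

definition is_mrf :: "'v mrf \<Rightarrow> bool" where
  "is_mrf G \<longleftrightarrow>
     finite (verts G) \<and>
     (\<forall>e\<in>edges G. \<exists>i\<in>verts G. \<exists>j\<in>verts G. i \<noteq> j \<and> e = {i, j}) \<and>
     (\<forall>i\<in>verts G. pos_distr (vals G) (prior G i)) \<and>
     (\<forall>i j. {i, j} \<in> edges G \<longrightarrow>
        (\<forall>x\<in>vals G. \<forall>y\<in>vals G. 0 < compat G i j x y \<and> compat G i j x y = compat G j i y x))"

definition nbrs :: "'v mrf \<Rightarrow> 'v \<Rightarrow> 'v set" where
  "nbrs G i = {j \<in> verts G. {i, j} \<in> edges G}"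

definition induced :: "'v mrf \<Rightarrow> 'v set \<Rightarrow> 'v mrf" where
  "induced G S = G\<lparr>verts := S, edges := {e \<in> edges G. e \<subseteq> S}\<rparr>"

definition acyclic_mrf :: "'v mrf \<Rightarrow> bool" where
  "acyclic_mrf G \<longleftrightarrow>
     \<not> (\<exists>vs. 3 \<le> length vs \<and> distinct vs \<and> set vs \<subseteq> verts G \<and>
          (\<forall>k<length vs. {vs ! k, vs ! (Suc k mod length vs)} \<in> edges G))"

section \<open>Belief propagation\<close>

text \<open>A message assignment \<open>m\<close> gives for every ordered pair of neighbours \<open>i\<close>, \<open>j\<close> the
  distribution \<open>m i j\<close> of the message from \<open>i\<close> to \<open>j\<close>.\<close>

type_synonym 'v messages = "'v \<Rightarrow> 'v \<Rightarrow> nat \<Rightarrow> real"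

definition bp_unnorm :: "'v mrf \<Rightarrow> 'v messages \<Rightarrow> 'v messages" where
  "bp_unnorm G m i j y =
     (\<Sum>x\<in>vals G. compat G i j x y * prior G i x * (\<Prod>k\<in>nbrs G i - {j}. m k i x))"

definition bp_step :: "'v mrf \<Rightarrow> 'v messages \<Rightarrow> 'v messages" where
  "bp_step G m i j y = bp_unnorm G m i j y / (\<Sum>z\<in>vals G. bp_unnorm G m i j z)"

text \<open>Convergence is required from all strictly positive initial messages, with one common limit,
  so that the uniform initialization in \<open>bp_limit\<close> is immaterial.\<close>

definition bp_converges :: "'v mrf \<Rightarrow> bool" where
  "bp_converges G \<longleftrightarrow>
     (\<exists>m. \<forall>m0. (\<forall>i\<in>verts G. \<forall>j\<in>nbrs G i. pos_distr (vals G) (m0 i j)) \<longrightarrow>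
        (\<forall>i\<in>verts G. \<forall>j\<in>nbrs G i. \<forall>x\<in>vals G.
           (\<lambda>n. (bp_step G ^^ n) m0 i j x) \<longlonglongrightarrow> m i j x))"

definition bp_limit :: "'v mrf \<Rightarrow> 'v messages" where
  "bp_limit G i j x = lim (\<lambda>n. (bp_step G ^^ n) (\<lambda>_ _ _. 1 / real (states G)) i j x)"

definition belief_unnorm :: "'v mrf \<Rightarrow> 'v \<Rightarrow> nat \<Rightarrow> real" where
  "belief_unnorm G X x = prior G X x * (\<Prod>Y\<in>nbrs G X. bp_limit G Y X x)"

definition belief :: "'v mrf \<Rightarrow> 'v \<Rightarrow> nat \<Rightarrow> real" where
  "belief G X x = belief_unnorm G X x / (\<Sum>z\<in>vals G. belief_unnorm G X z)"

section \<open>The objective\<close>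

definition KL :: "nat set \<Rightarrow> (nat \<Rightarrow> real) \<Rightarrow> (nat \<Rightarrow> real) \<Rightarrow> real" where
  "KL C p q = (\<Sum>x\<in>C. p x * ln (p x / q x))"

definition sym_KL :: "nat set \<Rightarrow> (nat \<Rightarrow> real) \<Rightarrow> (nat \<Rightarrow> real) \<Rightarrow> real" where
  "sym_KL C p q = KL C p q + KL C q p"

definition neg_objective :: "'v mrf \<Rightarrow> 'v \<Rightarrow> 'v set \<Rightarrow> real" where
  "neg_objective G X A = - sym_KL (vals G) (belief G X) (belief (induced G (insert X A)) X)"

definition explaining_sets :: "'v mrf \<Rightarrow> 'v \<Rightarrow> 'v set set" where
  "explaining_sets G X = {A. A \<subseteq> verts G - {X} \<and> acyclic_mrf (induced G (insert X A))}"

definition submodular_on :: "'v set set \<Rightarrow> ('v set \<Rightarrow> real) \<Rightarrow> bool" where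
  "submodular_on D f \<longleftrightarrow>
     (\<forall>A A' Y. A \<subseteq> A' \<and> Y \<notin> A' \<and> {A, A', insert Y A, insert Y A'} \<subseteq> D \<longrightarrow>
        f (insert Y A) - f A \<ge> f (insert Y A') - f A')"

end

theory Submission
  imports Defs
begin

text \<open>On a star, a message from a leaf to the centre \<open>X\<close> depends only on the leaf, so the belief of
  \<open>X\<close> is its prior times these messages. Take two leaves whose messages to a uniform \<open>X\<close> are
  mirror images of each other: together they cancel, so both the empty and the full explaining set
  reproduce the belief of \<open>X\<close> exactly, whereas a single leaf does not. Thus adding a leaf to the
  empty set strictly decreases the objective, and adding the second leaf strictly increases it.\<close>

section \<open>Positivity of the symmetric KL-divergence\<close>

lemma sym_KL_eq:
  assumes "\<forall>x\<in>C. 0 < p x" "\<forall>x\<in>C. 0 < q x"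
  shows "sym_KL C p q = (\<Sum>x\<in>C. (p x - q x) * (ln (p x) - ln (q x)))"
  unfolding sym_KL_def KL_def sum.distrib [symmetric]
  by (rule sum.cong) (use assms in \<open>auto simp: ln_div algebra_simps\<close>)

text \<open>In the form given by \<open>sym_KL_eq\<close>, both factors of each summand have the
  same sign because \<open>ln\<close> is increasing, and at \<open>z\<close> neither factor
  vanishes.\<close>

lemma sym_KL_pos:
  assumes "finite C" "\<forall>x\<in>C. 0 < p x" "\<forall>x\<in>C. 0 < q x" "z \<in> C" "p z \<noteq> q z"
  shows "0 < sym_KL C p q"
proof -
  have "0 \<le> (p x - q x) * (ln (p x) - ln (q x))" if "x \<in> C" for x
    using assms that by (auto simp: zero_le_mult_iff)
  moreover have "0 < (p z - q z) * (ln (p z) - ln (q z))"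
    using assms by (auto simp: zero_less_mult_iff)
  ultimately show ?thesis
    unfolding sym_KL_eq [OF assms(2,3)] using assms(1,4) by (intro sum_pos2)
qed

lemma sym_KL_eq_0:
  assumes "\<forall>x\<in>C. p x = q x"
  shows "sym_KL C p q = 0"
proof -
  have "KL C p q = 0" "KL C q p = 0"
    unfolding KL_def using assms by (auto intro!: sum.neutral)
  then show ?thesis by (simp add: sym_KL_def)
qed

section \<open>Stars and their acyclicity\<close>

text \<open>Phrased through edges alone, so that every induced subgraph inherits it. The second
  conjunct excludes a loop, which would make \<open>X\<close> its own neighbour.\<close>

definition star_at :: "'v mrf \<Rightarrow> 'v \<Rightarrow> bool" where
  "star_at G X \<longleftrightarrow> (\<forall>e\<in>edges G. X \<in> e) \<and> {X} \<notin> edges G"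

lemma induced_simps [simp]:
  "verts (induced G S) = S" "edges (induced G S) = {e \<in> edges G. e \<subseteq> S}"
  "vals (induced G S) = vals G" "prior (induced G S) = prior G" "compat (induced G S) = compat G"
  by (simp_all add: induced_def vals_def)

lemma star_at_induced:
  "star_at G X \<Longrightarrow> star_at (induced G S) X"
  by (auto simp: star_at_def)

text \<open>Every edge of a cycle \<open>vs\<close> would have to contain \<open>X\<close>. If
  \<open>X\<close> is entry 0, the edge from entry 1 to entry 2 misses it; if \<open>X\<close> is
  entry 1, the edge leaving entry 2 does; otherwise the edge from entry 0 to entry 1 does.\<close>

lemma acyclic_star:
  assumes "star_at G X"
  shows "acyclic_mrf G"
  unfolding acyclic_mrf_def
proof safe
  fix vs
  assume len: "3 \<le> length vs" and dist: "distinct vs"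
    and adj: "\<forall>k<length vs. {vs ! k, vs ! (Suc k mod length vs)} \<in> edges G"
  define n where "n = length vs"
  have n: "0 < n" "1 < n" "2 < n" "3 mod n < n"
    using len by (auto simp: n_def intro: mod_less_divisor)
  have X: "X = vs ! k \<or> X = vs ! (Suc k mod n)" if "k < n" for k
  proof -
    have "{vs ! k, vs ! (Suc k mod n)} \<in> edges G"
      using adj that by (simp add: n_def)
    then have "X \<in> {vs ! k, vs ! (Suc k mod n)}"
      using assms by (meson star_at_def)
    then show ?thesis by simp
  qed
  have neq: "vs ! i \<noteq> vs ! j" if "i < n" "j < n" "i \<noteq> j" for i j
    using dist that by (simp add: n_def nth_eq_iff_index_eq)
  \<comment> \<open>In a triangle the index 3 wraps round to 0; in a longer cycle it stays
    3.\<close>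
  have "3 mod n \<noteq> 1"
  proof (cases "n = 3")
    case False
    then have "3 < n" using n(3) by linarith
    then show ?thesis by simp
  qed simp
  then have "vs ! 1 \<noteq> vs ! (3 mod n)"
    using neq n by metis
  moreover have "vs ! 0 \<noteq> vs ! 1" "vs ! 0 \<noteq> vs ! 2" "vs ! 1 \<noteq> vs ! 2"
    by (rule neq; use n in simp)+
  moreover have "X = vs ! 0 \<or> X = vs ! 1"
    using X [OF n(1)] n(2) by simp
  moreover have "X = vs ! 1 \<or> X = vs ! 2"
    using X [OF n(2)] n(3) by (simp add: numeral_2_eq_2)
  moreover have "X = vs ! 2 \<or> X = vs ! (3 mod n)"
    using X [OF n(3)] by (simp only: eval_nat_numeral)
  ultimately show False by metis
qed

section \<open>Belief propagation on a star\<close>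

lemma nbrs_leaf:
  assumes "star_at G X" "Y \<noteq> X"
  shows "nbrs G Y - {X} = {}"
proof -
  have "j = X" if "{Y, j} \<in> edges G" for j
  proof -
    have "X \<in> {Y, j}" using assms(1) that unfolding star_at_def by (elim conjE) (erule (1) bspec)
    then show ?thesis using assms(2) by simp
  qed
  then show ?thesis by (auto simp: nbrs_def)
qed

lemma bp_unnorm_leaf:
  assumes "star_at G X" "Y \<noteq> X"
  shows "bp_unnorm G m Y X y = (\<Sum>x\<in>vals G. compat G Y X x y * prior G Y x)"
  by (simp add: bp_unnorm_def nbrs_leaf [OF assms])

lemma bp_step_leaf:
  assumes "star_at G X" "Y \<noteq> X"
  shows "bp_step G m Y X = bp_step G m' Y X"
  by (simp add: fun_eq_iff bp_step_def bp_unnorm_leaf [OF assms])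

lemma bp_step_cong:
  assumes "\<And>k. k \<in> nbrs G i - {j} \<Longrightarrow> m k i = m' k i"
  shows "bp_step G m i j = bp_step G m' i j"
proof -
  have "(\<Prod>k\<in>nbrs G i - {j}. m k i x) = (\<Prod>k\<in>nbrs G i - {j}. m' k i x)" for x
    by (rule prod.cong) (simp_all only: assms)
  then have "bp_unnorm G m i j y = bp_unnorm G m' i j y" for y
    by (simp only: bp_unnorm_def)
  then show ?thesis by (simp add: fun_eq_iff bp_step_def)
qed

text \<open>The first update settles the messages from leaves to the centre; the second computes the
  messages from the centre out of these alone. Hence nothing of the start survives two
  updates.\<close>

lemma bp_step_twice_star:
  assumes star: "star_at G X" and j: "j \<in> nbrs G i"
  shows "bp_step G (bp_step G m) i j = bp_step G (bp_step G m') i j"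
proof (cases "i = X")
  case True
  show ?thesis
  proof (rule bp_step_cong)
    fix k
    assume "k \<in> nbrs G i - {j}"
    then have "k \<noteq> X" using star True unfolding star_at_def nbrs_def by force
    then show "bp_step G m k i = bp_step G m' k i"
      unfolding True by (rule bp_step_leaf [OF star])
  qed
next
  case False
  then have "j = X" using nbrs_leaf [OF star False] j by blast
  show ?thesis unfolding \<open>j = X\<close> by (rule bp_step_leaf [OF star False])
qed

lemma bp_converges_star:
  assumes "star_at G X"
  shows "bp_converges G"
proof -
  \<comment> \<open>The zero messages are an arbitrary choice of start, since two updates erase
    it.\<close>
  define m where "m = bp_step G (bp_step G (\<lambda>_ _ _. 0))"
  have "(\<lambda>n. (bp_step G ^^ n) m0 i j x) \<longlonglongrightarrow> m i j x" if "j \<in> nbrs G i" for m0 i j x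
  proof (rule LIMSEQ_offset [where k = 2])
    have "(bp_step G ^^ (n + 2)) m0 i j x = m i j x" for n
      using bp_step_twice_star [OF assms that, of "(bp_step G ^^ n) m0" "\<lambda>_ _ _. 0"]
      by (simp add: m_def)
    then show "(\<lambda>n. (bp_step G ^^ (n + 2)) m0 i j x) \<longlonglongrightarrow> m i j x" by simp
  qed
  then show ?thesis unfolding bp_converges_def by blast
qed

text \<open>From the first update on, the message of a leaf is constant; the free \<open>m\<close>
  allows any convenient argument in a computation.\<close>

lemma bp_limit_leaf:
  assumes "star_at G X" "Y \<noteq> X"
  shows "bp_limit G Y X x = bp_step G m Y X x"
  unfolding bp_limit_def
proof (rule limI, rule LIMSEQ_offset [where k = 1])
  have "(bp_step G ^^ (n + 1)) m0 Y X x = bp_step G m Y X x" for n m0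
    using bp_step_leaf [OF assms, of "(bp_step G ^^ n) m0" m] by simp
  then show "(\<lambda>n. (bp_step G ^^ (n + 1)) (\<lambda>_ _ _. 1 / real (states G)) Y X x)
      \<longlonglongrightarrow> bp_step G m Y X x" by simp
qed

section \<open>The example with two cancelling leaves\<close>

text \<open>Leaves and states share the names 1 and 2: leaf \<open>i\<close> disfavours state
  \<open>i\<close>, so exchanging the leaves amounts to exchanging the states.\<close>

definition cancel_prior :: "nat \<Rightarrow> nat \<Rightarrow> real" where
  "cancel_prior i x = (if i = 0 then 1/2 else if i = x then 1/3 else 2/3)"

definition cancel_mrf :: "nat mrf" where
  "cancel_mrf = \<lparr>verts = {0, 1, 2}, edges = {{0, 1}, {0, 2}}, states = 2,
     prior = cancel_prior, compat = (\<lambda>_ _ x y. if x = y then 2 else 1)\<rparr>"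

lemma cancel_mrf_simps [simp]:
  "verts cancel_mrf = {0, 1, 2}" "edges cancel_mrf = {{0, 1}, {0, 2}}" "vals cancel_mrf = {1, 2}"
  "prior cancel_mrf = cancel_prior" "compat cancel_mrf = (\<lambda>_ _ x y. if x = y then 2 else 1)"
  by (auto simp: vals_def cancel_mrf_def)

lemma is_mrf_cancel: "is_mrf cancel_mrf"
proof -
  have "\<forall>i\<in>{0, 1, 2}. pos_distr {1, 2} (cancel_prior i)"
    by (simp add: pos_distr_def cancel_prior_def)
  moreover have "\<forall>e\<in>edges cancel_mrf. \<exists>i\<in>{0, 1, 2}. \<exists>j\<in>{0, 1, 2}. i \<noteq> j \<and> e = {i, j}"
    by simp
  ultimately show ?thesis
    unfolding is_mrf_def by simp
qed

lemma star_at_cancel: "star_at cancel_mrf 0"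
  by (auto simp: star_at_def)

lemma explaining_cancel: "explaining_sets cancel_mrf 0 = Pow {1, 2}"
  using acyclic_star [OF star_at_induced [OF star_at_cancel]]
  by (auto simp: explaining_sets_def)

lemma induced_cancel: "induced cancel_mrf {0, 1, 2} = cancel_mrf"
  by (auto simp: induced_def cancel_mrf_def)

lemma nbrs_cancel:
  assumes "A \<subseteq> {1, 2}"
  shows "nbrs (induced cancel_mrf (insert 0 A)) 0 = A"
  using assms by (auto simp: nbrs_def doubleton_eq_iff)

text \<open>Before normalization the message is 2 * 1/3 + 1 * 2/3 = 4/3 at state \<open>Y\<close>
  and 1 * 1/3 + 2 * 2/3 = 5/3 at the other state, with sum 3.\<close>

lemma bp_limit_cancel:
  assumes "Y \<in> {1, 2}" "x \<in> {1, 2}"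
  shows "bp_limit (induced cancel_mrf S) Y 0 x = (if Y = x then 4/9 else 5/9)"
proof -
  note star = star_at_induced [OF star_at_cancel]
  have Y: "Y \<noteq> 0" using assms by auto
  show ?thesis
    unfolding bp_limit_leaf [OF star Y, of _ _ "\<lambda>_ _ _. 0"] bp_step_def bp_unnorm_leaf [OF star Y]
    using assms by (auto simp: cancel_prior_def)
qed

lemma belief_unnorm_cancel:
  assumes "A \<subseteq> {1, 2}" "x \<in> {1, 2}"
  shows "belief_unnorm (induced cancel_mrf (insert 0 A)) 0 x =
    1/2 * (\<Prod>Y\<in>A. if Y = x then 4/9 else 5/9)"
proof -
  have "(\<Prod>Y\<in>A. bp_limit (induced cancel_mrf (insert 0 A)) Y 0 x) =
      (\<Prod>Y\<in>A. if Y = x then 4/9 else 5/9)"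
    using assms by (intro prod.cong refl bp_limit_cancel) blast+
  then show ?thesis
    unfolding belief_unnorm_def nbrs_cancel [OF assms(1)] by (simp add: cancel_prior_def)
qed

lemma belief_cancel:
  assumes "x \<in> {1, 2}"
  shows "belief cancel_mrf 0 x = 1/2"
    and "belief (induced cancel_mrf {0}) 0 x = 1/2"
    and "i \<in> {1, 2} \<Longrightarrow> belief (induced cancel_mrf {0, i}) 0 x = (if i = x then 4/9 else 5/9)"
proof -
  let ?P = "\<lambda>A z. 1/2 * (\<Prod>Y\<in>A. if Y = z then 4/9 else 5/9 :: real)"
  have b: "belief (induced cancel_mrf (insert 0 A)) 0 x = ?P A x / (\<Sum>z\<in>{1, 2}. ?P A z)"
    if "A \<subseteq> {1, 2}" for A
  proof -
    have "(\<Sum>z\<in>{1, 2}. belief_unnorm (induced cancel_mrf (insert 0 A)) 0 z) = (\<Sum>z\<in>{1, 2}. ?P A z)"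
      by (intro sum.cong refl belief_unnorm_cancel that)
    then show ?thesis
      by (simp only: belief_def induced_simps cancel_mrf_simps belief_unnorm_cancel [OF that assms])
  qed
  \<comment> \<open>The whole graph is the case of the full explaining set, where both states
    receive the product 4/9 * 5/9.\<close>
  show "belief cancel_mrf 0 x = 1/2"
    using assms b [of "{1, 2}"] by (auto simp: induced_cancel [simplified])
  show "belief (induced cancel_mrf {0}) 0 x = 1/2"
    using assms b [of "{}"] by simp
  show "belief (induced cancel_mrf {0, i}) 0 x = (if i = x then 4/9 else 5/9)" if "i \<in> {1, 2}"
    using that assms b [of "{i}"] by auto
qed

lemma neg_objective_cancel:
  shows "neg_objective cancel_mrf 0 {} = 0"
    and "neg_objective cancel_mrf 0 {1, 2} = 0"
    and "i \<in> {1, 2} \<Longrightarrow> neg_objective cancel_mrf 0 {i} < 0"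
proof -
  show "neg_objective cancel_mrf 0 {} = 0" "neg_objective cancel_mrf 0 {1, 2} = 0"
    by (auto simp: neg_objective_def induced_cancel [simplified] belief_cancel intro!: sym_KL_eq_0)
  show "neg_objective cancel_mrf 0 {i} < 0" if "i \<in> {1, 2}"
    \<comment> \<open>State 1 witnesses the difference: 1/2 against 4/9 or 5/9.\<close>
    using that sym_KL_pos [of "{1, 2}" "belief cancel_mrf 0"
        "belief (induced cancel_mrf {0, i}) 0" 1]
    by (auto simp: neg_objective_def belief_cancel)
qed

theorem mainTheorem1:
  shows "\<exists>(G :: nat mrf) X.
    is_mrf G \<and> bp_converges G \<and> X \<in> verts G \<and>
    \<not> submodular_on (explaining_sets G X) (neg_objective G X) \<and>
    \<not> mono_on (explaining_sets G X) (neg_objective G X)"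
proof (intro exI conjI)
  let ?f = "neg_objective cancel_mrf 0" and ?D = "explaining_sets cancel_mrf 0"
  note f = neg_objective_cancel
  show "is_mrf cancel_mrf" by (rule is_mrf_cancel)
  show "bp_converges cancel_mrf" by (rule bp_converges_star [OF star_at_cancel])
  show "0 \<in> verts cancel_mrf" by simp
  show "\<not> submodular_on ?D ?f"
  proof
    assume "submodular_on ?D ?f"
    \<comment> \<open>Leaf 1 is added to \<open>{2}\<close> and to \<open>{}\<close>: the gain on
      the left is positive, the one on the right negative.\<close>
    then have "?f (insert 1 {2}) - ?f {2} \<le> ?f (insert 1 {}) - ?f {}"
      unfolding submodular_on_def
      by (elim allE [where x = "{}"] allE [where x = "{2}"] allE [where x = 1])
        (simp add: explaining_cancel)
    then show False using f(1,2) f(3) [of 1] f(3) [of 2] by simp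
  qed
  show "\<not> mono_on ?D ?f"
  proof
    assume "mono_on ?D ?f"
    then have "?f {} \<le> ?f {1}"
      by (rule mono_onD) (auto simp: explaining_cancel)
    then show False using f(1) f(3) [of 1] by simp
  qed
qed

end
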